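(* Let $n\ge 2$ and $\sqrt{3(n-1)}\le a$, and let $f(x)=a|x^{(1)}|+\sum_{i=2}^n x^{(i)}$ on $\mathbb{R}^n$. When scaled memoryless BFGS is applied to $f$, using any Armijo-Wolfe line search, with any starting point $x_0$ such that $x_0^{(1)}\neq 0$, every direction $d_k$ generated by the method is a nonnegative scalar multiple of $$d_+=-\begin{bmatrix}1\\ \beta\mathbb{1}\end{bmatrix}\quad\text{or}\quad d_-=-\begin{bmatrix}-1\\ \beta\mathbb{1}\end{bmatrix}$$ for some $\beta>0$ (depending on $k$) with $\beta<a/(n-1)$. It follows that steplengths $t_k$ satisfying the Armijo and Wolfe conditions always exist, and hence the method never terminates.
   Context: Superscript $(i)$ denotes the $i$-th component of a vector, and $\mathbb{1}\in\mathbb{R}^{n-1}$ is the vector of all ones. The function $f$ is differentiable exactly at points with $x^{(1)}\neq 0$. Fix parameters $0<c_1<c_2<1$ (the Armijo and Wolfe parameters). Given $x$ at which $f$ is differentiable and a direction $d$ with $\nabla f(x)^Td<0$, a steplength $t>0$ satisfies the Armijo condition if $f(x+td)\le f(x)+c_1t\nabla f(x)^Td$, and the Wolfe condition if $\nabla f(x+td)$ exists and $\nabla f(x+td)^Td\ge c_2\nabla f(x)^Td$. An Armijo-Wolfe line search is any rule returning some $t$ satisfying both conditions (whenever such $t$ exists). Scaled memoryless BFGS (with input $x_0$): set $d_0=-\nabla f(x_0)$. For $k=1,2,3,\dots$: let $t_{k-1}$ be a steplength satisfying the Armijo and Wolfe conditions at $x_{k-1}$ along $d_{k-1}$ (if none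 exists, the method terminates); set $x_k=x_{k-1}+t_{k-1}d_{k-1}$, $s_{k-1}=x_k-x_{k-1}$, $y_{k-1}=\nabla f(x_k)-\nabla f(x_{k-1})$, $V_{k-1}=I-\dfrac{y_{k-1}s_{k-1}^T}{y_{k-1}^Ts_{k-1}}$, $H_k=\dfrac{s_{k-1}^Ty_{k-1}}{y_{k-1}^Ty_{k-1}}V_{k-1}^TV_{k-1}+\dfrac{s_{k-1}s_{k-1}^T}{s_{k-1}^Ty_{k-1}}$, and $d_k=-H_k\nabla f(x_k)$. *)

theory Defs
  imports "HOL-Analysis.Analysis"
begin

text \<open>The gradient is only meaningful where \<open>f\<close> is differentiable; elsewhere its value is
  unspecified, so uses of it are guarded by differentiability.\<close>

definition grad :: "('a::real_inner \<Rightarrow> real) \<Rightarrow> 'a \<Rightarrow> 'a" where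
  "grad f x = (THE g. GDERIV f x :> g)"

definition armijo :: "real \<Rightarrow> ('a::real_inner \<Rightarrow> real) \<Rightarrow> 'a \<Rightarrow> 'a \<Rightarrow> real \<Rightarrow> bool" where
  "armijo c1 f x d t \<longleftrightarrow> f (x + t *\<^sub>R d) \<le> f x + c1 * t * (grad f x \<bullet> d)"

definition wolfe :: "real \<Rightarrow> ('a::real_inner \<Rightarrow> real) \<Rightarrow> 'a \<Rightarrow> 'a \<Rightarrow> real \<Rightarrow> bool" where
  "wolfe c2 f x d t \<longleftrightarrow>
     f differentiable (at (x + t *\<^sub>R d)) \<and>
     grad f (x + t *\<^sub>R d) \<bullet> d \<ge> c2 * (grad f x \<bullet> d)"

text \<open>The two conditions are only considered for differentiable points and descent directions,
  so these requirements are part of being an admissible steplength.\<close>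

definition armijo_wolfe_step ::
  "real \<Rightarrow> real \<Rightarrow> ('a::real_inner \<Rightarrow> real) \<Rightarrow> 'a \<Rightarrow> 'a \<Rightarrow> real \<Rightarrow> bool" where
  "armijo_wolfe_step c1 c2 f x d t \<longleftrightarrow>
     f differentiable (at x) \<and> grad f x \<bullet> d < 0 \<and> t > 0 \<and>
     armijo c1 f x d t \<and> wolfe c2 f x d t"

text \<open>A line search may also consult the iteration number. For a fixed objective and starting
  point, every sequence of admissible steplengths (history-dependent or arbitrarily chosen) is
  therefore produced by some such rule. Its value is unconstrained if no admissible steplength
  exists.\<close>

definition armijo_wolfe_line_search ::
  "real \<Rightarrow> real \<Rightarrow> ('a::real_inner \<Rightarrow> real) \<Rightarrow> (nat \<Rightarrow> 'a \<Rightarrow> 'a \<Rightarrow> real) \<Rightarrow> bool" where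
  "armijo_wolfe_line_search c1 c2 f ls \<longleftrightarrow>
     (\<forall>k x d. (\<exists>t. armijo_wolfe_step c1 c2 f x d t) \<longrightarrow>
        armijo_wolfe_step c1 c2 f x d (ls k x d))"

definition outer :: "real^'m \<Rightarrow> real^'n \<Rightarrow> real^'n^'m" where
  "outer u v = (\<chi> i j. u $ i * v $ j)"

definition bfgs_V :: "real^'n \<Rightarrow> real^'n \<Rightarrow> real^'n^'n" where
  "bfgs_V s y = mat 1 - (1 / (y \<bullet> s)) *\<^sub>R outer y s"

definition bfgs_H :: "real^'n \<Rightarrow> real^'n \<Rightarrow> real^'n^'n" where
  "bfgs_H s y =
     ((s \<bullet> y) / (y \<bullet> y)) *\<^sub>R (transpose (bfgs_V s y) ** bfgs_V s y)
     + (1 / (s \<bullet> y)) *\<^sub>R outer s s"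

text \<open>The state after \<open>k\<close> iterations is \<open>Some (x\<^sub>k, d\<^sub>k)\<close>; it is \<open>None\<close> once the method has
  terminated for lack of an admissible steplength.\<close>

primrec memoryless_bfgs ::
  "real \<Rightarrow> real \<Rightarrow> (real^'n \<Rightarrow> real) \<Rightarrow> (nat \<Rightarrow> real^'n \<Rightarrow> real^'n \<Rightarrow> real) \<Rightarrow> real^'n \<Rightarrow>
   nat \<Rightarrow> ((real^'n) \<times> (real^'n)) option" where
  "memoryless_bfgs c1 c2 f ls x0 0 = Some (x0, - grad f x0)"
| "memoryless_bfgs c1 c2 f ls x0 (Suc k) =
     (case memoryless_bfgs c1 c2 f ls x0 k of
        None \<Rightarrow> None
      | Some (x, d) \<Rightarrow>
          if \<exists>t. armijo_wolfe_step c1 c2 f x d t then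
            (let x' = x + ls k x d *\<^sub>R d;
                 s = x' - x;
                 y = grad f x' - grad f x
             in Some (x', - (bfgs_H s y *v grad f x')))
          else None)"

text \<open>Coordinates are indexed by the finite type \<open>'n\<close>; the arbitrary index \<open>p\<close> plays the role
  of the first coordinate.\<close>

definition objective :: "'n \<Rightarrow> real \<Rightarrow> real^'n \<Rightarrow> real" where
  "objective p a x = a * \<bar>x $ p\<bar> + (\<Sum>i\<in>UNIV - {p}. x $ i)"

definition d_plus :: "'n \<Rightarrow> real \<Rightarrow> real^'n" where
  "d_plus p \<beta> = - (\<chi> i. if i = p then 1 else \<beta>)"

definition d_minus :: "'n \<Rightarrow> real \<Rightarrow> real^'n" where
  "d_minus p \<beta> = - (\<chi> i. if i = p then - 1 else \<beta>)"

end

theory Submission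
  imports Defs
begin

text \<open>Write \<open>m = n - 1\<close>. Every vector occurring in the run has equal entries off \<open>p\<close>. Let the sign of
  the \<open>p\<close>-th coordinate of the iterate be \<open>\<sigma>\<close>, and let the direction be a positive multiple
  of \<open>- (\<sigma>, \<beta>\<one>)\<close>. Since \<open>f\<close> is linear on either side of the kink, the Wolfe condition
  forces the step to cross it, so the next sign is \<open>- \<sigma>\<close>; then one BFGS update gives a positive
  multiple of \<open>- (- \<sigma>, \<beta>'\<one>)\<close> with \<open>\<beta>' = (1 - a \<beta> + 2 m \<beta>\<^sup>2) / (a - m \<beta>)\<close>. When
  \<open>a\<^sup>2 \<ge> 3 m\<close> this recursion maps the interval \<open>(0, 1/a]\<close> to itself, and it starts at
  \<open>\<beta> = 1/a\<close>. A step past the kink satisfying the Armijo condition always exists because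
  \<open>m \<beta> < a\<close>.\<close>

section \<open>Vectors with a common entry off \<open>p\<close>\<close>

definition split_vec :: "'n \<Rightarrow> real \<Rightarrow> real \<Rightarrow> real^'n" where
  "split_vec p u v = (\<chi> i. if i = p then u else v)"

lemma split_vec_nth: "split_vec p u v $ i = (if i = p then u else v)"
  by (simp add: split_vec_def)

lemma split_vec_nth_self [simp]: "split_vec p u v $ p = u"
  by (simp add: split_vec_nth)

lemma uminus_split_vec: "- split_vec p u v = split_vec p (- u) (- v)"
  by (simp add: vec_eq_iff split_vec_nth)

lemma diff_split_vec: "split_vec p u v - split_vec p u' v' = split_vec p (u - u') (v - v')"
  by (simp add: vec_eq_iff split_vec_nth)

lemma add_split_vec: "split_vec p u v + split_vec p u' v' = split_vec p (u + u') (v + v')"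
  by (simp add: vec_eq_iff split_vec_nth)

lemma scaleR_split_vec: "c *\<^sub>R split_vec p u v = split_vec p (c * u) (c * v)"
  by (simp add: vec_eq_iff split_vec_nth)

lemmas split_vec_arith = uminus_split_vec diff_split_vec add_split_vec scaleR_split_vec

lemma inner_split_vec_right:
  fixes p :: "'n::finite"
  shows "x \<bullet> split_vec p u v = x $ p * u + v * (\<Sum>i\<in>UNIV - {p}. x $ i)"
proof -
  have "x \<bullet> split_vec p u v = (\<Sum>i\<in>UNIV. x $ i * (if i = p then u else v))"
    by (simp add: inner_vec_def split_vec_nth)
  also have "\<dots> = x $ p * u + (\<Sum>i\<in>UNIV - {p}. x $ i * (if i = p then u else v))"
    by (subst sum.remove[of _ p]) auto
  also have "(\<Sum>i\<in>UNIV - {p}. x $ i * (if i = p then u else v)) = (\<Sum>i\<in>UNIV - {p}. x $ i * v)"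
    by (rule sum.cong) auto
  finally show ?thesis
    by (simp add: sum_distrib_left mult.commute)
qed

lemma sum_off_split_vec:
  fixes p :: "'n::finite"
  shows "(\<Sum>i\<in>UNIV - {p}. split_vec p u v $ i) = (real CARD('n) - 1) * v"
proof -
  have "(\<Sum>i\<in>UNIV - {p}. split_vec p u v $ i) = (\<Sum>i\<in>UNIV - {p}. v)"
    by (rule sum.cong) (auto simp: split_vec_nth)
  then show ?thesis
    by (simp add: card_Diff_singleton of_nat_diff Suc_leI)
qed

text \<open>Turns inner products of such vectors into scalar arithmetic in a plane with weights
  \<open>1\<close> and \<open>real CARD('n) - 1\<close>.\<close>

lemma inner_split_vec:
  fixes p :: "'n::finite"
  shows "split_vec p u v \<bullet> split_vec p u' v' = u * u' + (real CARD('n) - 1) * v * v'"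
  by (simp add: inner_split_vec_right sum_off_split_vec)

lemma d_plus_eq_split_vec: "d_plus p \<beta> = split_vec p (- 1) (- \<beta>)"
  by (simp add: d_plus_def split_vec_def vec_eq_iff)

lemma d_minus_eq_split_vec: "d_minus p \<beta> = split_vec p 1 (- \<beta>)"
  by (simp add: d_minus_def split_vec_def vec_eq_iff)

section \<open>Action of the BFGS matrices on vectors\<close>

lemma outer_matrix_vector_mult: "outer u v *v w = (v \<bullet> w) *\<^sub>R u"
  by (simp add: vec_eq_iff outer_def matrix_vector_mult_def inner_vec_def sum_distrib_right
      sum_distrib_left mult_ac)

lemma transpose_outer: "transpose (outer u v) = outer v u"
  by (simp add: vec_eq_iff outer_def transpose_def)

lemma bfgs_V_mult: "bfgs_V s y *v w = w - ((s \<bullet> w) / (y \<bullet> s)) *\<^sub>R y"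
  by (simp add: bfgs_V_def matrix_vector_mult_diff_rdistrib scaleR_matrix_vector_assoc[symmetric]
      outer_matrix_vector_mult)

lemma transpose_bfgs_V: "transpose (bfgs_V s y) = mat 1 - (1 / (y \<bullet> s)) *\<^sub>R outer s y"
proof -
  have "transpose (bfgs_V s y) = transpose (mat 1) - (1 / (y \<bullet> s)) *\<^sub>R transpose (outer y s)"
    by (simp add: vec_eq_iff transpose_def bfgs_V_def)
  then show ?thesis
    by (simp add: transpose_outer transpose_mat)
qed

lemma transpose_bfgs_V_mult: "transpose (bfgs_V s y) *v w = w - ((y \<bullet> w) / (y \<bullet> s)) *\<^sub>R s"
  by (simp add: transpose_bfgs_V matrix_vector_mult_diff_rdistrib
      scaleR_matrix_vector_assoc[symmetric] outer_matrix_vector_mult)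

text \<open>Trades matrices for inner products, so that an update stays within the span of the
  vectors involved.\<close>

lemma bfgs_H_mult:
  "bfgs_H s y *v w =
     ((s \<bullet> y) / (y \<bullet> y)) *\<^sub>R (transpose (bfgs_V s y) *v (bfgs_V s y *v w))
     + ((s \<bullet> w) / (s \<bullet> y)) *\<^sub>R s"
  by (simp add: bfgs_H_def matrix_vector_mult_add_rdistrib scaleR_matrix_vector_assoc[symmetric]
      matrix_vector_mul_assoc[symmetric] outer_matrix_vector_mult)

section \<open>Gradient and kink of the objective\<close>

lemma objective_eq_inner:
  fixes p :: "'n::finite"
  assumes "y $ p * \<sigma> = \<bar>y $ p\<bar>"
  shows "objective p a y = y \<bullet> split_vec p (\<sigma> * a) 1"
  using assms by (simp add: objective_def inner_split_vec_right algebra_simps)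

text \<open>On the open half-space of points on the same side of the kink as \<open>x\<close>, the
  objective coincides with a linear function, whose derivative transfers.\<close>

lemma GDERIV_objective:
  fixes p :: "'n::finite"
  assumes "x $ p \<noteq> 0"
  shows "GDERIV (objective p a) x :> split_vec p (sgn (x $ p) * a) 1"
proof -
  let ?g = "split_vec p (sgn (x $ p) * a) 1"
  let ?S = "{y :: real^'n. y $ p * x $ p > 0}"
  have "open ?S"
    by (intro open_Collect_less continuous_intros)
  moreover have "x \<in> ?S"
    using assms by (simp add: zero_less_mult_iff) linarith
  moreover have "y \<bullet> ?g = objective p a y" if "y \<in> ?S" for y
    using that by (subst objective_eq_inner[where \<sigma> = "sgn (x $ p)"])
      (auto simp: zero_less_mult_iff)
  moreover have "((\<lambda>y. y \<bullet> ?g) has_derivative (\<lambda>h. h \<bullet> ?g)) (at x)"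
    by (intro derivative_eq_intros) auto
  ultimately show ?thesis
    unfolding gderiv_def using has_derivative_transform_within_open[of "\<lambda>y. y \<bullet> ?g"] by blast
qed

lemma differentiable_objective:
  fixes p :: "'n::finite"
  assumes "x $ p \<noteq> 0"
  shows "objective p a differentiable (at x)"
  using GDERIV_objective[OF assms] by (auto simp: gderiv_def differentiable_def)

lemma grad_objective:
  fixes p :: "'n::finite"
  assumes "x $ p \<noteq> 0"
  shows "grad (objective p a) x = split_vec p (sgn (x $ p) * a) 1"
  unfolding grad_def
proof (rule the_equality)
  fix g assume "GDERIV (objective p a) x :> g"
  then have "(\<lambda>h. h \<bullet> g) = (\<lambda>h. h \<bullet> split_vec p (sgn (x $ p) * a) 1)"
    using GDERIV_objective[OF assms] unfolding gderiv_def by (metis has_derivative_unique)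
  then show "g = split_vec p (sgn (x $ p) * a) 1"
    by (metis vector_eq_ldot)
qed (rule GDERIV_objective[OF assms])

lemma abs_not_differentiable_0: "\<not> (\<lambda>t::real. \<bar>t\<bar>) differentiable (at 0)"
proof
  \<comment> \<open>Both \<open>\<bar>t\<bar>\<close> and \<open>\<bar>t\<bar> - t\<close> are minimal at \<open>0\<close>, so both would have derivative \<open>0\<close>.\<close>
  assume "(\<lambda>t::real. \<bar>t\<bar>) differentiable (at 0)"
  then obtain D where D: "((\<lambda>t::real. \<bar>t\<bar>) has_field_derivative D) (at 0)"
    by (auto simp: real_differentiable_def)
  have D': "((\<lambda>t::real. \<bar>t\<bar> - t) has_field_derivative D - 1) (at 0)"
    by (intro DERIV_diff D DERIV_ident)
  have "D = 0"
    by (rule DERIV_local_min[OF D zero_less_one]) auto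
  moreover have "D - 1 = 0"
    by (rule DERIV_local_min[OF D' zero_less_one]) auto
  ultimately show False
    by simp
qed

text \<open>Along the line through a kink point in the \<open>p\<close>-th coordinate direction, the
  objective is \<open>a * \<bar>t\<bar>\<close> plus a constant; undoing this affine change would
  make the absolute value differentiable at \<open>0\<close>.\<close>

lemma differentiable_objective_imp:
  fixes p :: "'n::finite"
  assumes "objective p a differentiable (at x)" and "a \<noteq> 0"
  shows "x $ p \<noteq> 0"
proof
  assume x0: "x $ p = 0"
  let ?l = "\<lambda>t::real. x + split_vec p t 0"
  have l: "?l = (\<lambda>t. x + t *\<^sub>R split_vec p 1 0)"
    by (simp add: scaleR_split_vec)
  have "?l differentiable (at 0)"
    unfolding l by (intro derivative_intros)
  moreover have "x = ?l 0"
    by (simp add: vec_eq_iff split_vec_nth)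
  ultimately have "(\<lambda>t. objective p a (?l t)) differentiable (at 0)"
    using assms(1) differentiable_chain_at[of ?l 0 "objective p a"] by (simp add: o_def)
  moreover have "objective p a (?l t) = a * \<bar>t\<bar> + (\<Sum>i\<in>UNIV - {p}. x $ i)" for t
    using x0 by (auto simp: objective_def split_vec_nth intro!: sum.cong)
  ultimately have "(\<lambda>t. a * \<bar>t\<bar> + (\<Sum>i\<in>UNIV - {p}. x $ i)) differentiable (at 0)"
    by simp
  then have "(\<lambda>t. inverse a * ((a * \<bar>t\<bar> + (\<Sum>i\<in>UNIV - {p}. x $ i))
      - (\<Sum>i\<in>UNIV - {p}. x $ i))) differentiable (at 0)"
    by (intro differentiable_mult differentiable_diff differentiable_const)
  moreover have "inverse a * ((a * \<bar>t\<bar> + (\<Sum>i\<in>UNIV - {p}. x $ i)) - (\<Sum>i\<in>UNIV - {p}. x $ i)) = \<bar>t\<bar>"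
    for t
    using \<open>a \<noteq> 0\<close> by (simp add: mult.assoc[symmetric])
  ultimately have "(\<lambda>t::real. \<bar>t\<bar>) differentiable (at 0)"
    by (simp only:)
  then show False
    using abs_not_differentiable_0 by blast
qed

section \<open>Admissible steplengths at the kink\<close>

lemma exists_armijo_wolfe_step:
  fixes p :: "'n::finite" and x :: "real^'n"
  assumes c: "0 < c1" "c1 < 1" "0 < c2"
    and a: "0 < a" and \<beta>: "0 < \<beta>" "(real CARD('n) - 1) * \<beta> < a"
    and x: "x $ p \<noteq> 0" and r: "0 < r"
    and d: "d = r *\<^sub>R split_vec p (- sgn (x $ p)) (- \<beta>)"
  shows "\<exists>t. armijo_wolfe_step c1 c2 (objective p a) x d t"
proof
  define m where "m = real CARD('n) - 1"
  define \<sigma> where "\<sigma> = sgn (x $ p)"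
  \<comment> \<open>With this step the \<open>p\<close>-th coordinate alone attains equality in the Armijo condition.\<close>
  define t where "t = 2 * \<bar>x $ p\<bar> / ((1 + c1) * r)"
  have m: "0 \<le> m"
    by (simp add: m_def Suc_leI)
  have \<sigma>: "\<sigma> * \<sigma> = 1" "x $ p = \<sigma> * \<bar>x $ p\<bar>" "\<sigma> * x $ p = \<bar>x $ p\<bar>"
    using x by (auto simp: \<sigma>_def sgn_if)
  have t: "0 < t"
    using c r x by (simp add: t_def)
  have tr: "t * r = 2 * \<bar>x $ p\<bar> / (1 + c1)"
    using r c by (simp add: t_def)
  let ?x' = "x + t *\<^sub>R d"
  \<comment> \<open>\<open>q\<close> is the distance past the kink: the step uses up
    \<open>\<bar>x $ p\<bar>\<close> to reach it and overshoots by \<open>q\<close>, which is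
    positive since \<open>c1 < 1\<close>.\<close>
  define q where "q = (1 - c1) / (1 + c1) * \<bar>x $ p\<bar>"
  have q: "0 < q"
    using c x by (simp add: q_def)
  have q': "t * r = \<bar>x $ p\<bar> + q"
    unfolding tr q_def using c by (simp add: divide_simps) (simp add: algebra_simps)
  have q'': "q - \<bar>x $ p\<bar> = - c1 * (t * r)"
    unfolding tr q_def using c by (simp add: divide_simps) (simp add: algebra_simps)
  have x'p: "?x' $ p = - \<sigma> * q"
  proof -
    have "?x' $ p = \<sigma> * \<bar>x $ p\<bar> - \<sigma> * (t * r)"
      using \<sigma>(2) by (simp add: d \<sigma>_def[symmetric] mult_ac)
    then show ?thesis unfolding q' by (simp add: algebra_simps)
  qed
  have x'0: "?x' $ p \<noteq> 0"
    unfolding x'p using q \<sigma>(1) by auto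
  have sgn': "sgn (?x' $ p) = - \<sigma>"
    unfolding x'p using q x by (simp add: sgn_mult \<sigma>_def)
  have abs': "\<bar>?x' $ p\<bar> = q"
    unfolding x'p using q x by (simp add: abs_mult \<sigma>_def abs_sgn_eq)
  have gd: "grad (objective p a) x \<bullet> d = - r * (a + m * \<beta>)"
    using \<sigma>(1) by (simp add: grad_objective[OF x] d scaleR_split_vec inner_split_vec
        \<sigma>_def[symmetric] m_def[symmetric] algebra_simps)
  have gd': "grad (objective p a) ?x' \<bullet> d = r * (a - m * \<beta>)"
    unfolding grad_objective[OF x'0] sgn' using \<sigma>(1)
    by (simp add: d scaleR_split_vec inner_split_vec
        \<sigma>_def[symmetric] m_def[symmetric] algebra_simps)
  have neg: "grad (objective p a) x \<bullet> d < 0"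
    unfolding gd using r a m \<beta> by (simp add: mult_pos_pos add_pos_nonneg)
  \<comment> \<open>Beyond the kink the slope along \<open>d\<close> is nonnegative because
    \<open>m * \<beta> < a\<close>, whereas the Wolfe bound is negative.\<close>
  have pos': "0 \<le> grad (objective p a) ?x' \<bullet> d"
    unfolding gd' using r \<beta> by (simp add: m_def)
  have off: "(\<Sum>i\<in>UNIV - {p}. ?x' $ i) = (\<Sum>i\<in>UNIV - {p}. x $ i) - m * \<beta> * (t * r)"
  proof -
    have "(\<Sum>i\<in>UNIV - {p}. ?x' $ i)
        = (\<Sum>i\<in>UNIV - {p}. x $ i) + t * r * (\<Sum>i\<in>UNIV - {p}. split_vec p (- \<sigma>) (- \<beta>) $ i)"
      by (simp add: d \<sigma>_def sum.distrib sum_distrib_left mult.assoc)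
    then show ?thesis by (simp add: sum_off_split_vec m_def algebra_simps)
  qed
  have "objective p a ?x' - objective p a x = a * (q - \<bar>x $ p\<bar>) - m * \<beta> * (t * r)"
    unfolding objective_def off abs' by (simp add: algebra_simps)
  also have "\<dots> = - c1 * (t * r) * a - m * \<beta> * (t * r)"
    by (simp add: q'')
  \<comment> \<open>The coordinates off \<open>p\<close> achieve their full predicted decrease, of
    which Armijo asks only the fraction \<open>c1\<close>.\<close>
  also have "\<dots> \<le> - c1 * (t * r) * a - c1 * (m * \<beta> * (t * r))"
    using c m \<beta> t r by (simp add: mult_left_le_one_le)
  also have "\<dots> = c1 * t * (grad (objective p a) x \<bullet> d)"
    by (simp add: gd algebra_simps)
  finally have "armijo c1 (objective p a) x d t"
    by (simp add: armijo_def)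
  moreover have "wolfe c2 (objective p a) x d t"
  proof -
    have "c2 * (grad (objective p a) x \<bullet> d) \<le> 0"
      using neg c by (simp add: mult_le_0_iff)
    then show ?thesis
      using pos' differentiable_objective[OF x'0] by (auto simp: wolfe_def)
  qed
  ultimately show "armijo_wolfe_step c1 c2 (objective p a) x d t"
    using differentiable_objective[OF x] neg t by (simp add: armijo_wolfe_step_def)
qed

text \<open>The differentiability demanded by Wolfe rules out landing on the kink. On the same side
  the gradient would be unchanged, so a negative slope would have to be at least \<open>c2\<close>
  times itself, impossible for \<open>c2 < 1\<close>.\<close>

lemma armijo_wolfe_step_crosses_kink:
  fixes p :: "'n::finite" and x :: "real^'n"
  assumes step: "armijo_wolfe_step c1 c2 (objective p a) x d t"
    and "c2 < 1" "a \<noteq> 0" and x: "x $ p \<noteq> 0"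
  shows "(x + t *\<^sub>R d) $ p \<noteq> 0" and "sgn ((x + t *\<^sub>R d) $ p) = - sgn (x $ p)"
proof -
  let ?x' = "x + t *\<^sub>R d"
  have neg: "grad (objective p a) x \<bullet> d < 0" and diff: "objective p a differentiable (at ?x')"
    and wolfe: "grad (objective p a) ?x' \<bullet> d \<ge> c2 * (grad (objective p a) x \<bullet> d)"
    using step by (auto simp: armijo_wolfe_step_def wolfe_def)
  show x': "?x' $ p \<noteq> 0"
    using differentiable_objective_imp[OF diff \<open>a \<noteq> 0\<close>] .
  have "sgn (?x' $ p) \<noteq> sgn (x $ p)"
  proof
    assume "sgn (?x' $ p) = sgn (x $ p)"
    then have "grad (objective p a) ?x' = grad (objective p a) x"
      by (simp only: grad_objective[OF x'] grad_objective[OF x])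
    then show False
      using wolfe neg \<open>c2 < 1\<close> by (simp add: mult_le_cancel_right1)
  qed
  then show "sgn (?x' $ p) = - sgn (x $ p)"
    using x x' by (auto simp: sgn_if split: if_splits)
qed

section \<open>One BFGS update and the recursion for \<beta>\<close>

lemma bfgs_direction:
  fixes p :: "'n::finite"
  defines "m \<equiv> real CARD('n) - 1"
  assumes \<sigma>: "\<sigma> * \<sigma> = 1" and a: "a \<noteq> 0" and \<tau>: "\<tau> \<noteq> 0" and \<beta>: "m * \<beta> \<noteq> a"
    and s: "s = \<tau> *\<^sub>R split_vec p (- \<sigma>) (- \<beta>)" and y: "y = split_vec p (- 2 * \<sigma> * a) 0"
  shows "- (bfgs_H s y *v split_vec p (- \<sigma> * a) 1) =
    (\<tau> * (a - m * \<beta>) / (2 * a)) *\<^sub>R split_vec p \<sigma> (- ((1 - a * \<beta> + 2 * m * \<beta>\<^sup>2) / (a - m * \<beta>)))"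
proof -
  \<comment> \<open>Here \<open>\<sigma>\<close> is the sign before the step and \<open>?g\<close>
    the gradient beyond the kink. Only the \<open>p\<close>-th gradient entry flips, so
    \<open>y\<close> vanishes off \<open>p\<close>.\<close>
  let ?g = "split_vec p (- \<sigma> * a) 1"
  have \<sigma>2: "\<sigma> * (\<sigma> * z) = z" for z
    using \<sigma> by (simp add: mult.assoc[symmetric])
  have sy: "s \<bullet> y = 2 * a * \<tau>" "y \<bullet> s = 2 * a * \<tau>"
    by (simp_all add: s y scaleR_split_vec inner_split_vec \<sigma>2 mult_ac)
  have yy: "y \<bullet> y = 4 * a\<^sup>2"
    by (simp add: y inner_split_vec power2_eq_square mult_ac \<sigma>2)
  have sg: "s \<bullet> ?g = \<tau> * (a - m * \<beta>)"
    by (simp add: s scaleR_split_vec inner_split_vec m_def[symmetric] algebra_simps \<sigma>2)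
  \<comment> \<open>Removing a multiple of \<open>y\<close> makes the result orthogonal to
    \<open>s\<close> and leaves the entries off \<open>p\<close> at \<open>1\<close>.\<close>
  have V: "bfgs_V s y *v ?g = split_vec p (- \<sigma> * m * \<beta>) 1"
    unfolding bfgs_V_mult sy sg unfolding y split_vec_arith using a \<tau>
    by (simp add: field_simps)
  have "y \<bullet> split_vec p (- \<sigma> * m * \<beta>) 1 = 2 * a * m * \<beta>"
    by (simp add: y inner_split_vec algebra_simps \<sigma>2)
  \<comment> \<open>The transpose maps into the orthogonal complement of \<open>y\<close>, hence the
    zero at \<open>p\<close>.\<close>
  then have VV: "transpose (bfgs_V s y) *v (bfgs_V s y *v ?g) = split_vec p 0 (1 + m * \<beta>\<^sup>2)"
    unfolding V transpose_bfgs_V_mult sy unfolding s split_vec_arith using a \<tau>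
    by (simp add: power2_eq_square mult_ac)
  \<comment> \<open>The \<open>p\<close>-th entry now comes from the term in \<open>s\<close> alone.
    Factoring out its size leaves
    \<open>(1 + m * \<beta>\<^sup>2) - \<beta> * (a - m * \<beta>)\<close> as the numerator of the
    new \<beta>.\<close>
  show ?thesis
    unfolding bfgs_H_mult VV sy yy sg unfolding s split_vec_arith using a \<tau> \<beta>
    by (intro arg_cong2[where f = "split_vec p"]) (simp_all add: field_simps power2_eq_square)
qed

text \<open>The threshold on \<open>a\<close> originates here: the last bound amounts to
  \<open>a\<^sup>2 - m - 2 * m * (a * \<beta>) \<ge> 0\<close>, which at the extreme
  \<open>a * \<beta> = 1\<close> is exactly \<open>3 * m \<le> a\<^sup>2\<close>.\<close>

lemma beta_recursion_bounds:
  fixes a m \<beta> :: real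
  assumes a: "0 < a" and m: "0 < m" "3 * m \<le> a\<^sup>2" and \<beta>: "0 < \<beta>" "a * \<beta> \<le> 1"
  shows "m * \<beta> < a"
    and "0 < (1 - a * \<beta> + 2 * m * \<beta>\<^sup>2) / (a - m * \<beta>)"
    and "a * ((1 - a * \<beta> + 2 * m * \<beta>\<^sup>2) / (a - m * \<beta>)) \<le> 1"
proof -
  have "a * (m * \<beta>) \<le> m"
    using m \<beta> by (simp add: mult.left_commute)
  also have "m < a * a"
    using m by (simp add: power2_eq_square)
  finally show lt: "m * \<beta> < a"
    using a by simp
  have "0 < 1 - a * \<beta> + 2 * m * \<beta>\<^sup>2"
    using m \<beta> by (intro add_nonneg_pos) auto
  then show "0 < (1 - a * \<beta> + 2 * m * \<beta>\<^sup>2) / (a - m * \<beta>)"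
    using lt by simp
  have "2 * m * (a * \<beta>) \<le> 2 * m * 1"
    using m \<beta> by (intro mult_left_mono) auto
  then have "2 * m * (a * \<beta>) \<le> a\<^sup>2 - m"
    using m by linarith
  then have "0 \<le> \<beta> * (a\<^sup>2 - m - 2 * m * (a * \<beta>))"
    using \<beta> by simp
  also have "\<dots> = (a - m * \<beta>) - a * (1 - a * \<beta> + 2 * m * \<beta>\<^sup>2)"
    by (simp add: algebra_simps power2_eq_square)
  finally show "a * ((1 - a * \<beta> + 2 * m * \<beta>\<^sup>2) / (a - m * \<beta>)) \<le> 1"
    using lt by (simp add: divide_le_eq)
qed

text \<open>The loop invariant: the direction points towards the kink. It carries
  \<open>a * \<beta> \<le> 1\<close> because this bound reproduces itself under the recursion and
  implies the required \<open>m * \<beta> < a\<close>.\<close>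

definition kink_direction :: "'n \<Rightarrow> real \<Rightarrow> real^'n \<Rightarrow> real^'n \<Rightarrow> bool" where
  "kink_direction p a x d \<longleftrightarrow> x $ p \<noteq> 0 \<and>
     (\<exists>r>0. \<exists>\<beta>>0. a * \<beta> \<le> 1 \<and> d = r *\<^sub>R split_vec p (- sgn (x $ p)) (- \<beta>))"

lemma kink_direction_update:
  fixes p :: "'n::finite" and x :: "real^'n"
  defines "m \<equiv> real CARD('n) - 1"
  assumes a: "0 < a" and m: "0 < m" "3 * m \<le> a\<^sup>2" and "c2 < 1"
    and dir: "kink_direction p a x d"
    and step: "armijo_wolfe_step c1 c2 (objective p a) x d t"
  defines "x' \<equiv> x + t *\<^sub>R d"
  shows "kink_direction p a x'
    (- (bfgs_H (x' - x) (grad (objective p a) x' - grad (objective p a) x)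
        *v grad (objective p a) x'))"
proof -
  from dir obtain r \<beta> where x: "x $ p \<noteq> 0" and r: "0 < r" and \<beta>: "0 < \<beta>" "a * \<beta> \<le> 1"
    and d: "d = r *\<^sub>R split_vec p (- sgn (x $ p)) (- \<beta>)"
    unfolding kink_direction_def by blast
  define \<sigma> where "\<sigma> = sgn (x $ p)"
  have \<sigma>: "\<sigma> * \<sigma> = 1"
    using x by (simp add: \<sigma>_def sgn_if)
  have t: "0 < t"
    using step by (simp add: armijo_wolfe_step_def)
  have x': "x' $ p \<noteq> 0" "sgn (x' $ p) = - \<sigma>"
    using armijo_wolfe_step_crosses_kink[OF step \<open>c2 < 1\<close> _ x] a by (auto simp: x'_def \<sigma>_def)
  note bounds = beta_recursion_bounds[OF a m \<beta>]
  have s: "x' - x = (t * r) *\<^sub>R split_vec p (- \<sigma>) (- \<beta>)"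
    by (simp add: x'_def d \<sigma>_def)
  have g': "grad (objective p a) x' = split_vec p (- \<sigma> * a) 1"
    using grad_objective[OF x'(1)] x'(2) by simp
  have y: "grad (objective p a) x' - grad (objective p a) x = split_vec p (- 2 * \<sigma> * a) 0"
    by (simp add: g' grad_objective[OF x] \<sigma>_def[symmetric] diff_split_vec mult.assoc)
  have "t * r \<noteq> 0" "a \<noteq> 0" "m * \<beta> \<noteq> a"
    using t r a bounds(1) by auto
  note H = bfgs_direction[OF \<sigma> this(2,1) this(3)[unfolded m_def] s y, folded m_def g']
  have "0 < t * r * (a - m * \<beta>) / (2 * a)"
    using t r a bounds(1) by simp
  \<comment> \<open>Since the new sign is \<open>- \<sigma>\<close>, the entry
    \<open>\<sigma>\<close> produced by the update again points towards the kink; the positive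
    factor serves as the new \<open>r\<close>.\<close>
  then show ?thesis
    unfolding kink_direction_def H x'(2) minus_minus using x'(1) bounds(2,3) by blast
qed

section \<open>The start and the induction along the run\<close>

lemma kink_direction_init:
  fixes p :: "'n::finite"
  assumes "0 < a" "x $ p \<noteq> 0"
  shows "kink_direction p a x (- grad (objective p a) x)"
proof -
  have "- grad (objective p a) x = a *\<^sub>R split_vec p (- sgn (x $ p)) (- (1 / a))"
    using assms by (simp add: grad_objective split_vec_arith mult.commute)
  moreover have "0 < 1 / a" "a * (1 / a) \<le> 1"
    using assms by auto
  ultimately show ?thesis
    unfolding kink_direction_def using assms by blast
qed

theorem theorem3:
  fixes p :: "'n::finite" and a c1 c2 :: real and x0 :: "real^'n"
    and ls :: "nat \<Rightarrow> real^'n \<Rightarrow> real^'n \<Rightarrow> real"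
  assumes "0 < c1" and "c1 < c2" and "c2 < 1"
    and "CARD('n) \<ge> 2"
    and "sqrt (3 * (real CARD('n) - 1)) \<le> a"
    and "x0 $ p \<noteq> 0"
    and "armijo_wolfe_line_search c1 c2 (objective p a) ls"
  shows "(\<forall>k x d. memoryless_bfgs c1 c2 (objective p a) ls x0 k = Some (x, d) \<longrightarrow>
            (\<exists>\<beta>>0. \<beta> < a / (real CARD('n) - 1) \<and>
               (\<exists>c\<ge>0. d = c *\<^sub>R d_plus p \<beta> \<or> d = c *\<^sub>R d_minus p \<beta>)))
       \<and> (\<forall>k x d. memoryless_bfgs c1 c2 (objective p a) ls x0 k = Some (x, d) \<longrightarrow>
            (\<exists>t. armijo_wolfe_step c1 c2 (objective p a) x d t))
       \<and> (\<forall>k. memoryless_bfgs c1 c2 (objective p a) ls x0 k \<noteq> None)"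
proof -
  define m where "m = real CARD('n) - 1"
  have m: "0 < m"
    using \<open>CARD('n) \<ge> 2\<close> by (simp add: m_def)
  have a: "0 < a"
    using m \<open>sqrt (3 * (real CARD('n) - 1)) \<le> a\<close> less_le_trans[of 0 "sqrt (3 * m)" a]
    by (simp flip: m_def)
  have m3: "3 * m \<le> a\<^sup>2"
    using \<open>sqrt (3 * (real CARD('n) - 1)) \<le> a\<close> by (simp add: sqrt_le_D flip: m_def)
  note m' = m[unfolded m_def] m3[unfolded m_def]
  have step: "\<exists>t. armijo_wolfe_step c1 c2 (objective p a) x d t" if "kink_direction p a x d" for x d
  proof -
    from that obtain r \<beta> where x: "x $ p \<noteq> 0" and r: "0 < r" and \<beta>: "0 < \<beta>" "a * \<beta> \<le> 1"
      and d: "d = r *\<^sub>R split_vec p (- sgn (x $ p)) (- \<beta>)"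
      unfolding kink_direction_def by blast
    show ?thesis
      using assms(1-3) exists_armijo_wolfe_step[OF _ _ _ a \<beta>(1)
        beta_recursion_bounds(1)[OF a m' \<beta>] x r d] by force
  qed
  \<comment> \<open>Survival and direction shape are proved together: the invariant supplies an
    admissible steplength, which excludes \<open>None\<close> and is also what makes the value of
    \<open>ls\<close> admissible.\<close>
  have inv: "\<exists>x d. memoryless_bfgs c1 c2 (objective p a) ls x0 k = Some (x, d) \<and>
      kink_direction p a x d" for k
  proof (induction k)
    case 0
    show ?case
      using kink_direction_init[OF a \<open>x0 $ p \<noteq> 0\<close>] by simp
  next
    case (Suc k)
    then obtain x d where xd: "memoryless_bfgs c1 c2 (objective p a) ls x0 k = Some (x, d)"
      and dir: "kink_direction p a x d"
      by blast
    have "armijo_wolfe_step c1 c2 (objective p a) x d (ls k x d)"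
      using step[OF dir] \<open>armijo_wolfe_line_search c1 c2 (objective p a) ls\<close>
      by (simp add: armijo_wolfe_line_search_def)
    from kink_direction_update[OF a m' \<open>c2 < 1\<close> dir this] show ?case
      using xd step[OF dir] by (simp add: Let_def)
  qed
  have form: "\<exists>\<beta>>0. \<beta> < a / (real CARD('n) - 1) \<and>
      (\<exists>c\<ge>0. d = c *\<^sub>R d_plus p \<beta> \<or> d = c *\<^sub>R d_minus p \<beta>)" if dir: "kink_direction p a x d" for x d
  proof -
    from dir obtain r \<beta> where x: "x $ p \<noteq> 0" and r: "0 < r" and \<beta>: "0 < \<beta>" "a * \<beta> \<le> 1"
      and d: "d = r *\<^sub>R split_vec p (- sgn (x $ p)) (- \<beta>)"
      unfolding kink_direction_def by blast
    have "\<beta> < a / (real CARD('n) - 1)"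
      using beta_recursion_bounds(1)[OF a m' \<beta>] m' by (simp add: pos_less_divide_eq mult.commute)
    \<comment> \<open>A positive \<open>p\<close>-th coordinate gives \<open>d_plus\<close>, a
      negative one \<open>d_minus\<close>.\<close>
    moreover have "d = r *\<^sub>R d_plus p \<beta> \<or> d = r *\<^sub>R d_minus p \<beta>"
      using x by (cases "x $ p > 0") (auto simp: d d_plus_eq_split_vec d_minus_eq_split_vec)
    ultimately show ?thesis
      using \<beta>(1) r less_imp_le by blast
  qed
  have dir: "kink_direction p a x d"
    if "memoryless_bfgs c1 c2 (objective p a) ls x0 k = Some (x, d)" for k x d
    using inv[of k] that by auto
  show ?thesis
    using form[OF dir] step[OF dir] inv by fastforce
qed

end
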